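(* Let $(X,\rho)$ be a metric space. Then every function $f\in\mathbb{H}_{ft}(X)$ has a continuous majorant and a continuous minorant, i.e. there exist $\varphi,\psi\in C(X)$ with $\varphi\le f\le\psi$; that is, $\mathbb{H}_{cm}(X)=\mathbb{H}_{ft}(X)$.
   Context: Let $\overline{\mathbb{R}}=\mathbb{R}\cup\{\pm\infty\}$ and let $\mathbb{I}\overline{\mathbb{R}}=\{[\underline a,\overline a]:\underline a,\overline a\in\overline{\mathbb{R}},\ \underline a\le\overline a\}$ be the set of closed intervals $[\underline a,\overline a]=\{z\in\overline{\mathbb R}:\underline a\le z\le\overline a\}$, partially ordered by $[\underline a,\overline a]\le[\underline b,\overline b]\iff \underline a\le\underline b$ and $\overline a\le\overline b$. A point $x\in\overline{\mathbb{R}}$ is identified with $[x,x]$. For a topological space $X$ let $\mathbb{A}(X)$ be the set of all functions $f:X\to\mathbb{I}\overline{\mathbb{R}}$, ordered pointwise: $f\le g\iff f(x)\le g(x)$ for all $x\in X$. Let $\mathcal{A}(X)\subset\mathbb{A}(X)$ be the set of functions $X\to\overline{\mathbb{R}}$. With $\mathcal{V}_x$ the set of neighborhoods of $x$, define for $f\in\mathbb{A}(X)$ the functions $I(f),S(f)\in\mathcal{A}(X)$ and $F(f)\in\mathbb{A}(X)$ by $I(f)(x)=\sup_{V\in\mathcal{V}_x}\inf\{z\in f(y):y\in V\}$, $S(f)(x)=\inf_{V\in\mathcal{V}_x}\sup\{z\in f(y):y\in V\}$, $F(f)(x)=[I(f)(x),S(f)(x)]$. A function $f\in\mathbb{A}(X)$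 is Hausdorff continuous (H-continuous) if for every $g\in\mathbb{A}(X)$ with $g(x)\subseteq f(x)$ for all $x\in X$ one has $F(g)(x)=f(x)$ for all $x\in X$. $\mathbb{H}(X)$ is the set of all H-continuous functions on $X$, and $\mathbb{H}_{ft}(X)=\{f\in\mathbb{H}(X): f(x)\subseteq\mathbb{R}\text{ for all }x\in X\}$. $C(X)$ is the set of all continuous functions $X\to\mathbb{R}$, and $\mathbb{H}_{cm}(X)=\{f\in\mathbb{H}_{ft}(X):\exists\varphi,\psi\in C(X):\ \varphi\le f\le\psi\}$. *)

theory Defs
  imports "HOL-Analysis.Analysis" "HOL-Library.Interval"
begin

text \<open>
  Extended real intervals are represented by \<^typ>\<open>ereal interval\<close>, with endpoints \<^const>\<open>lower\<close> and
  \<^const>\<open>upper\<close> and point set \<^const>\<open>set_of\<close>. The library order on \<^typ>\<open>ereal interval\<close> is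
  inclusion, so the endpointwise order needs its own name.
\<close>

definition ivl_le :: "ereal interval \<Rightarrow> ereal interval \<Rightarrow> bool"  (infix "\<preceq>\<^sub>I" 50)
  where "a \<preceq>\<^sub>I b \<longleftrightarrow> lower a \<le> lower b \<and> upper a \<le> upper b"

definition fun_ivl_le :: "('a \<Rightarrow> ereal interval) \<Rightarrow> ('a \<Rightarrow> ereal interval) \<Rightarrow> bool"
    (infix "\<preceq>\<^sub>F" 50)
  where "f \<preceq>\<^sub>F g \<longleftrightarrow> (\<forall>x. f x \<preceq>\<^sub>I g x)"

definition neighborhoods :: "'a::topological_space \<Rightarrow> 'a set set"
  where "neighborhoods x = {V. \<exists>U. open U \<and> x \<in> U \<and> U \<subseteq> V}"

definition lower_baire :: "('a::topological_space \<Rightarrow> ereal interval) \<Rightarrow> 'a \<Rightarrow> ereal"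
  where "lower_baire f x = (SUP V\<in>neighborhoods x. Inf (\<Union>y\<in>V. set_of (f y)))"

definition upper_baire :: "('a::topological_space \<Rightarrow> ereal interval) \<Rightarrow> 'a \<Rightarrow> ereal"
  where "upper_baire f x = (INF V\<in>neighborhoods x. Sup (\<Union>y\<in>V. set_of (f y)))"

definition graph_completion ::
    "('a::topological_space \<Rightarrow> ereal interval) \<Rightarrow> 'a \<Rightarrow> ereal interval"
  where "graph_completion f x = Interval (lower_baire f x, upper_baire f x)"

text \<open>
  \<^const>\<open>Interval\<close> is unspecified on pairs that are not ordered; the next lemma shows that this
  case does not arise.
\<close>

lemma lower_baire_le_upper_baire: "lower_baire f x \<le> upper_baire f x"
  unfolding lower_baire_def upper_baire_def
proof (intro SUP_least INF_greatest)
  fix V W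
  assume "V \<in> neighborhoods x" and "W \<in> neighborhoods x"
  then have "x \<in> V" and "x \<in> W"
    by (auto simp: neighborhoods_def)
  moreover have "lower (f x) \<in> set_of (f x)"
    by (simp add: set_of_eq)
  ultimately have "lower (f x) \<in> (\<Union>y\<in>V. set_of (f y))" "lower (f x) \<in> (\<Union>y\<in>W. set_of (f y))"
    by blast+
  then show "Inf (\<Union>y\<in>V. set_of (f y)) \<le> Sup (\<Union>y\<in>W. set_of (f y))"
    by (meson Inf_lower Sup_upper order_trans)
qed

lemma lower_graph_completion [simp]: "lower (graph_completion f x) = lower_baire f x"
  and upper_graph_completion [simp]: "upper (graph_completion f x) = upper_baire f x"
  by (simp_all add: graph_completion_def lower_def upper_def Interval_inverse
      lower_baire_le_upper_baire)

definition H_continuous :: "('a::topological_space \<Rightarrow> ereal interval) \<Rightarrow> bool"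
  where "H_continuous f \<longleftrightarrow>
    (\<forall>g. (\<forall>x. set_of (g x) \<subseteq> set_of (f x)) \<longrightarrow> (\<forall>x. graph_completion g x = f x))"

definition H_space :: "('a::topological_space \<Rightarrow> ereal interval) set"
  where "H_space = {f. H_continuous f}"

definition H_ft :: "('a::topological_space \<Rightarrow> ereal interval) set"
  where "H_ft = {f \<in> H_space. \<forall>x. set_of (f x) \<subseteq> range ereal}"

definition C_space :: "('a::topological_space \<Rightarrow> real) set"
  where "C_space = {\<phi>. continuous_on UNIV \<phi>}"

text \<open>The identification of a real function with a function taking degenerate intervals as values.\<close>

definition point_fun :: "('a \<Rightarrow> real) \<Rightarrow> 'a \<Rightarrow> ereal interval"
  where "point_fun \<phi> x = interval_of (ereal (\<phi> x))"

definition H_cm :: "('a::topological_space \<Rightarrow> ereal interval) set"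
  where "H_cm = {f \<in> H_ft. \<exists>\<phi>\<in>C_space. \<exists>\<psi>\<in>C_space. point_fun \<phi> \<preceq>\<^sub>F f \<and> f \<preceq>\<^sub>F point_fun \<psi>}"

end

theory Submission
  imports Defs
begin

text \<open>
  An H-continuous function is its own graph completion, so its upper endpoint at a point is the
  infimum of its suprema over neighborhoods. If that infimum is finite, the function is bounded
  above on some neighborhood, and dually for the lower endpoint. Thus both endpoint functions of
  a finite H-continuous function are locally bounded on the appropriate side, and the theorem
  reduces to a fact about metric spaces: a locally upper bounded real function \<open>u\<close> has a
  continuous majorant (\<open>locally_bounded_above_imp_continuous_majorant\<close>).

  This fact needs no partition of unity. The function \<open>w = 1 / max 1 u\<close> is positive and locally
  bounded away from zero. Its infimal convolution with the metric,
  \<open>s x = (INF y. w y + dist x y)\<close>, is 1-Lipschitz, lies below \<open>w\<close>, and is still positive: points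
  \<open>y\<close> close to \<open>x\<close> contribute at least the local lower bound of \<open>w\<close>, and the others at least
  their distance from \<open>x\<close>. Hence \<open>1 / s\<close> is continuous and lies above \<open>1 / w\<close>, hence above \<open>u\<close>.
\<close>

text \<open>
  The infimal convolution \<open>s\<close> of \<open>w\<close> with the metric is the largest 1-Lipschitz function below
  \<open>w\<close>; the local lower bounds on \<open>w\<close> keep it from reaching zero.
\<close>

lemma locally_bounded_below_imp_Lipschitz_minorant:
  fixes w :: "'a::metric_space \<Rightarrow> real"
  assumes pos: "\<And>x. 0 < w x"
    and loc: "\<And>x. \<exists>e>0. \<exists>c>0. \<forall>y\<in>ball x e. c \<le> w y"
  obtains s where "1-lipschitz_on UNIV s" "\<And>x. 0 < s x" "\<And>x. s x \<le> w x"
proof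
  define s where "s = (\<lambda>x. INF y. w y + dist x y)"
  have bdd: "bdd_below (range (\<lambda>y. w y + dist x y))" for x
    by (rule bdd_belowI[of _ 0]) (auto intro: add_nonneg_nonneg less_imp_le[OF pos])
  have s_le: "s x \<le> w y + dist x y" for x y
    unfolding s_def by (rule cINF_lower[OF bdd]) simp
  have shift: "s x \<le> s y + dist x y" for x y
  proof -
    have "s x - dist x y \<le> w z + dist y z" for z
      using s_le[of x z] dist_triangle[of x z y] by linarith
    then have "s x - dist x y \<le> s y"
      unfolding s_def[THEN fun_cong, of y] by (intro cINF_greatest) auto
    then show ?thesis
      by simp
  qed
  show "1-lipschitz_on UNIV s"
  proof (rule lipschitz_onI)
    show "dist (s x) (s y) \<le> 1 * dist x y" for x y
      using shift[of x y] shift[of y x] by (simp add: dist_real_def dist_commute)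
  qed simp
  show "s x \<le> w x" for x
    using s_le[of x x] by simp
  show "0 < s x" for x
  proof -
    obtain e c where "0 < e" "0 < c" and c: "\<And>y. dist x y < e \<Longrightarrow> c \<le> w y"
      using loc[of x] by auto
    have "min c e \<le> w y + dist x y" for y
      using c[of y] pos[of y] zero_le_dist[of x y] by linarith
    then have "min c e \<le> s x"
      unfolding s_def by (intro cINF_greatest) auto
    then show ?thesis
      using \<open>0 < e\<close> \<open>0 < c\<close> by linarith
  qed
qed

lemma locally_bounded_above_imp_continuous_majorant:
  fixes u :: "'a::metric_space \<Rightarrow> real"
  assumes loc: "\<And>x. \<exists>e>0. \<exists>B. \<forall>y\<in>ball x e. u y \<le> B"
  obtains \<psi> where "continuous_on UNIV \<psi>" "\<And>x. u x \<le> \<psi> x"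
proof -
  define w where "w = (\<lambda>x. 1 / max 1 (u x))"
  have "\<exists>e>0. \<exists>c>0. \<forall>y\<in>ball x e. c \<le> w y" for x
  proof -
    obtain e B where "0 < e" and B: "\<And>y. y \<in> ball x e \<Longrightarrow> u y \<le> B"
      using loc[of x] by blast
    have "1 / max 1 B \<le> w y" if "y \<in> ball x e" for y
      unfolding w_def using B[OF that] by (intro divide_left_mono) auto
    then show ?thesis
      using \<open>0 < e\<close> by (intro exI[of _ e] conjI exI[of _ "1 / max 1 B"]) auto
  qed
  moreover have "0 < w x" for x
    by (simp add: w_def)
  ultimately obtain s where s: "1-lipschitz_on UNIV s" "\<And>x. 0 < s x" "\<And>x. s x \<le> w x"
    using locally_bounded_below_imp_Lipschitz_minorant[of w] by blast
  show thesis
  proof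
    show "continuous_on UNIV (\<lambda>x. 1 / s x)"
      using lipschitz_on_continuous_on[OF s(1)] s(2)
      by (intro continuous_intros) (auto simp: less_imp_neq[symmetric])
    show "u x \<le> 1 / s x" for x
    proof -
      have "s x * max 1 (u x) \<le> 1"
        using s(3)[of x] by (simp add: w_def pos_le_divide_eq)
      then have "max 1 (u x) \<le> 1 / s x"
        using s(2)[of x] by (metis pos_le_divide_eq mult.commute)
      then show ?thesis
        by simp
    qed
  qed
qed

text \<open>H-continuity compares \<open>f\<close> with all functions inside it; \<open>f\<close> itself is one of them.\<close>

lemma H_continuous_imp_baire:
  assumes "H_continuous f"
  shows "lower_baire f x = lower (f x)" "upper_baire f x = upper (f x)"
proof -
  have "graph_completion f x = f x"
    using assms unfolding H_continuous_def by blast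
  then show "lower_baire f x = lower (f x)" "upper_baire f x = upper (f x)"
    using lower_graph_completion[of f x] upper_graph_completion[of f x] by simp_all
qed

lemma endpoints_in_set_of:
  "lower i \<in> set_of i" "upper i \<in> set_of i" for i :: "'a::preorder interval"
  by (simp_all add: set_of_eq)

lemma neighborhoods_imp_ball:
  fixes x :: "'a::metric_space"
  assumes "V \<in> neighborhoods x"
  obtains e where "0 < e" "ball x e \<subseteq> V"
  using assms unfolding neighborhoods_def mem_Collect_eq by (meson open_contains_ball subset_trans)

text \<open>
  An infimum below \<open>\<infinity>\<close> is witnessed by a single neighborhood, on which \<open>f\<close> is bounded by a real.
\<close>

lemma upper_baire_finite_imp_bounded_above:
  fixes f :: "'a::metric_space \<Rightarrow> ereal interval"
  assumes "upper_baire f x < \<infinity>"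
  shows "\<exists>e>0. \<exists>B::real. \<forall>y\<in>ball x e. upper (f y) \<le> ereal B"
proof -
  obtain B where "upper_baire f x < ereal B"
    using assms ereal_dense2 by blast
  then obtain V where V: "V \<in> neighborhoods x" "Sup (\<Union>y\<in>V. set_of (f y)) < ereal B"
    unfolding upper_baire_def INF_less_iff by blast
  obtain e where e: "0 < e" "ball x e \<subseteq> V"
    using V(1) by (rule neighborhoods_imp_ball)
  have "upper (f y) \<le> ereal B" if "y \<in> ball x e" for y
  proof -
    have "upper (f y) \<in> (\<Union>y\<in>V. set_of (f y))"
      using that e(2) by (blast intro: endpoints_in_set_of)
    then show ?thesis
      using V(2) by (meson Sup_upper less_imp_le order_trans)
  qed
  then show ?thesis
    using e(1) by blast
qed

lemma lower_baire_finite_imp_bounded_below: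
  fixes f :: "'a::metric_space \<Rightarrow> ereal interval"
  assumes "- \<infinity> < lower_baire f x"
  shows "\<exists>e>0. \<exists>B::real. \<forall>y\<in>ball x e. ereal B \<le> lower (f y)"
proof -
  obtain B where "ereal B < lower_baire f x"
    using assms ereal_dense2 by blast
  then obtain V where V: "V \<in> neighborhoods x" "ereal B < Inf (\<Union>y\<in>V. set_of (f y))"
    unfolding lower_baire_def less_SUP_iff by blast
  obtain e where e: "0 < e" "ball x e \<subseteq> V"
    using V(1) by (rule neighborhoods_imp_ball)
  have "ereal B \<le> lower (f y)" if "y \<in> ball x e" for y
  proof -
    have "lower (f y) \<in> (\<Union>y\<in>V. set_of (f y))"
      using that e(2) by (blast intro: endpoints_in_set_of)
    then show ?thesis
      using V(2) by (meson Inf_lower less_imp_le order_trans)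
  qed
  then show ?thesis
    using e(1) by blast
qed

lemma H_ft_endpoints:
  assumes "f \<in> H_ft"
  obtains l u :: "'a::topological_space \<Rightarrow> real"
  where "\<And>x. lower (f x) = ereal (l x)" "\<And>x. upper (f x) = ereal (u x)"
proof -
  have "lower (f x) \<in> range ereal" "upper (f x) \<in> range ereal" for x
  proof -
    have "set_of (f x) \<subseteq> range ereal"
      using assms by (simp add: H_ft_def)
    then show "lower (f x) \<in> range ereal" "upper (f x) \<in> range ereal"
      using endpoints_in_set_of by blast+
  qed
  then have "lower (f x) = ereal (real_of_ereal (lower (f x)))"
    "upper (f x) = ereal (real_of_ereal (upper (f x)))" for x
    by (metis imageE real_of_ereal.simps(1))+
  then show thesis
    by (rule that)
qed

lemma H_ft_imp_continuous_majorant_minorant: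
  fixes f :: "'a::metric_space \<Rightarrow> ereal interval"
  assumes f: "f \<in> H_ft"
  shows "\<exists>\<phi>\<in>C_space. \<exists>\<psi>\<in>C_space. point_fun \<phi> \<preceq>\<^sub>F f \<and> f \<preceq>\<^sub>F point_fun \<psi>"
proof -
  obtain l u where l: "\<And>x. lower (f x) = ereal (l x)" and u: "\<And>x. upper (f x) = ereal (u x)"
    using f by (rule H_ft_endpoints) blast
  have "H_continuous f"
    using f by (simp add: H_ft_def H_space_def)
  note baire = H_continuous_imp_baire[OF this]
  have "\<exists>e>0. \<exists>B. \<forall>y\<in>ball x e. u y \<le> B" for x
    using upper_baire_finite_imp_bounded_above[of f x] by (simp add: baire u)
  then obtain \<psi> where \<psi>: "continuous_on UNIV \<psi>" "\<And>x. u x \<le> \<psi> x"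
    using locally_bounded_above_imp_continuous_majorant[of u] by blast
  \<comment> \<open>A minorant of \<open>l\<close> is the negative of a majorant of \<open>- l\<close>.\<close>
  have "\<exists>e>0. \<exists>B. \<forall>y\<in>ball x e. - l y \<le> B" for x
  proof -
    obtain e B where "0 < e" "\<forall>y\<in>ball x e. B \<le> l y"
      using lower_baire_finite_imp_bounded_below[of f x] by (auto simp: baire l simp del: mem_ball)
    then show ?thesis
      by (intro exI[of _ e] conjI exI[of _ "- B"]) auto
  qed
  then obtain \<phi> where \<phi>: "continuous_on UNIV \<phi>" "\<And>x. - l x \<le> \<phi> x"
    using locally_bounded_above_imp_continuous_majorant[of "\<lambda>x. - l x"] by blast
  have minor: "- \<phi> x \<le> l x" for x
    using \<phi>(2)[of x] by simp
  have lu: "l x \<le> u x" for x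
    using lower_le_upper[of "f x"] by (simp add: l u)
  have "point_fun (\<lambda>x. - \<phi> x) \<preceq>\<^sub>F f"
    using minor order_trans[OF minor lu] by (simp add: fun_ivl_le_def ivl_le_def point_fun_def l u)
  moreover have "f \<preceq>\<^sub>F point_fun \<psi>"
    using \<psi>(2) order_trans[OF lu \<psi>(2)] by (simp add: fun_ivl_le_def ivl_le_def point_fun_def l u)
  moreover have "(\<lambda>x. - \<phi> x) \<in> C_space" "\<psi> \<in> C_space"
    using \<phi>(1) \<psi>(1) by (auto simp: C_space_def intro: continuous_intros)
  ultimately show ?thesis
    by blast
qed

theorem theorem11:
  shows "(\<forall>f \<in> (H_ft :: ('a::metric_space \<Rightarrow> ereal interval) set).
            \<exists>\<phi>\<in>C_space. \<exists>\<psi>\<in>C_space. point_fun \<phi> \<preceq>\<^sub>F f \<and> f \<preceq>\<^sub>F point_fun \<psi>)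
       \<and> (H_cm :: ('a \<Rightarrow> ereal interval) set) = H_ft"
  using H_ft_imp_continuous_majorant_minorant unfolding H_cm_def by blast

end
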